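(* Let $\tau,\beta>0$, $N=N_1+N_2$, $\mathcal{N}_1=\{1,\dots,N_1\}$, $\mathcal{N}_2=\{N_1+1,\dots,N\}$. Let $A=\begin{pmatrix} A_1 & A_2 \\ A_3 & A_4 \end{pmatrix}$ be a nonnegative adjacency matrix, with blocks indexed by $\mathcal{N}_1,\mathcal{N}_2$, such that $A_1$ is circulant, generated by $(a_0,\dots,a_{N_1-1})$, and satisfies the cone condition $\sum_{l=1}^{N_1-1}a_l\cos(\phi_l)(1-\cos(k\phi_l))>0$ for all $k\in\{1,\dots,N_1-1\}$, where $\phi_l=\frac{2\pi l}{N_1}$; $A_2=A_4=0$; and for each $k\in\mathcal{N}_2$ there exists a unique $i_k\in\mathcal{N}_1$ such that the entry $a_{i_kk}$ of $A_3$ expressing the influence of agent $i_k$ on agent $k$ is positive, every other element of $A_3$ being zero. Thus the system is $$\dot z_j=\sum_{l=1}^{N_1}(A_1)_{jl}(z_l-z_j)+\frac1\tau\Bigl(1-\frac{|z_j|^2}{\beta^2}\Bigr)z_j,\ j\in\mathcal{N}_1,\qquad \dot z_k=a_{i_kk}(z_{i_k}-z_k)+\frac1\tau\Bigl(1-\frac{|z_k|^2}{\beta^2}\Bigr)z_k,\ k\in\mathcal{N}_2.$$ Let $d=\sum_{l=1}^{N_1-1}a_l$, $\rho=\sum_{l=1}^{N_1-1}a_l\cos\phi_l$, $\omega=\sum_{l=1}^{N_1-1}a_l\sin\phi_l$ with $\omega\ne0$, and $R=\beta\sqrt{\tau(\rho-d+\frac1\tau)}$. Suppose that $\tau<\tau^{**}$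 and that $a_{i_kk}>a^*$ for all $k\in\mathcal{N}_2$, where $$a^*=\frac{\tau\omega^2\beta^2}{2R^2}\left(\sqrt{1+\frac{4R^2}{\omega^2\tau^2\beta^2}}-1\right).$$ Then there exists a linearly stable rotational state of the form $$z_j=R\,e^{i(\omega t+\frac{2\pi j}{N_1}+\theta)},\quad j\in\mathcal{N}_1,\qquad z_k=r_k\,e^{i(\omega t+\theta_k^* )},\quad k\in\mathcal{N}_2,$$ with constants $r_k>0$ and $\theta,\theta_k^*\in\mathbb{R}/2\pi\mathbb{Z}$.
   Context: $A_1$ is circulant generated by $(a_0,\dots,a_{N_1-1})$ if $(A_1)_{jl}=a_{(l-j)\bmod N_1}$ with remainder in $\{0,\dots,N_1-1\}$. Linear stability of a rotating state with angular velocity $\omega$ (of the leader system alone, or of the full system): in polar coordinates $z_j=r_je^{i\theta_j}$ and in the frame rotating at speed $\omega$ the state is a fixed point, and the Jacobian there has $0$ as a simple eigenvalue (due to invariance under global rotation) and all other eigenvalues with strictly negative real part. $\tau^{**}$ denotes a stability threshold for the leaders: a number $\tau^{**}>0$, with $\tau^{**}\le(d-\rho)^{-1}$, such that for all $0<\tau<\tau^{**}$ the leaders' rotational twisted state $z_j=Re^{i(\omega t+\frac{2\pi j}{N_1}+\theta)}$, $j\in\mathcal{N}_1$, is a linearly stable solution of the leader subsystem. *)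

theory Defs
  imports "HOL-Analysis.Analysis" "Jordan_Normal_Form.Char_Poly"
begin

text \<open>
  Agents are numbered \<open>1, \<dots>, n\<close>. A network is a matrix \<open>A :: nat \<Rightarrow> nat \<Rightarrow> real\<close>, read only at
  indices in \<open>{1..n}\<close>, where \<open>A j l\<close> is the influence of agent \<open>l\<close> on agent \<open>j\<close>. Hence the system
  of the first \<open>m\<close> agents alone is obtained by passing \<open>m\<close> for \<open>n\<close>, with the same \<open>A\<close>.
\<close>

definition agent_field ::
  "nat \<Rightarrow> (nat \<Rightarrow> nat \<Rightarrow> real) \<Rightarrow> real \<Rightarrow> real \<Rightarrow> (nat \<Rightarrow> complex) \<Rightarrow> nat \<Rightarrow> complex" where
  "agent_field n A \<tau> \<beta> z j =
     (\<Sum>l\<in>{1..n}. of_real (A j l) * (z l - z j))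
     + of_real (1 / \<tau> * (1 - (cmod (z j))\<^sup>2 / \<beta>\<^sup>2)) * z j"

definition is_solution ::
  "nat \<Rightarrow> (nat \<Rightarrow> nat \<Rightarrow> real) \<Rightarrow> real \<Rightarrow> real \<Rightarrow> (real \<Rightarrow> nat \<Rightarrow> complex) \<Rightarrow> bool" where
  "is_solution n A \<tau> \<beta> z \<longleftrightarrow>
     (\<forall>t. \<forall>j\<in>{1..n}. ((\<lambda>s. z s j) has_vector_derivative agent_field n A \<tau> \<beta> (z t) j) (at t))"

definition rotating_state ::
  "real \<Rightarrow> (nat \<Rightarrow> real) \<Rightarrow> (nat \<Rightarrow> real) \<Rightarrow> real \<Rightarrow> nat \<Rightarrow> complex" where
  "rotating_state \<omega> r \<theta> t j = of_real (r j) * cis (\<omega> * t + \<theta> j)"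

text \<open>
  The polar coordinates of \<open>n\<close> agents are listed as \<open>r\<^sub>1, \<theta>\<^sub>1, r\<^sub>2, \<theta>\<^sub>2, \<dots>, r\<^sub>n, \<theta>\<^sub>n\<close>
  at the positions \<open>0, \<dots>, 2 * n - 1\<close>.
\<close>

definition polar_coords :: "(nat \<Rightarrow> real) \<Rightarrow> (nat \<Rightarrow> real) \<Rightarrow> nat \<Rightarrow> real" where
  "polar_coords r \<theta> i = (if even i then r (i div 2 + 1) else \<theta> (i div 2 + 1))"

definition coord_radius :: "(nat \<Rightarrow> real) \<Rightarrow> nat \<Rightarrow> real" where
  "coord_radius x j = x (2 * (j - 1))"

definition coord_angle :: "(nat \<Rightarrow> real) \<Rightarrow> nat \<Rightarrow> real" where
  "coord_angle x j = x (2 * (j - 1) + 1)"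

text \<open>
  From \<open>z\<^sub>j = r\<^sub>j e\<^bsup>i\<theta>\<^sub>j\<^esup>\<close> one gets \<open>r\<^sub>j' + i r\<^sub>j \<theta>\<^sub>j' = e\<^bsup>-i\<theta>\<^sub>j\<^esup> z\<^sub>j'\<close>; passing to the frame
  rotating at speed \<open>\<omega>\<close> subtracts \<open>\<omega>\<close> from each \<open>\<theta>\<^sub>j'\<close>.
\<close>

definition polar_field ::
  "nat \<Rightarrow> (nat \<Rightarrow> nat \<Rightarrow> real) \<Rightarrow> real \<Rightarrow> real \<Rightarrow> real \<Rightarrow> (nat \<Rightarrow> real) \<Rightarrow> nat \<Rightarrow> real" where
  "polar_field n A \<tau> \<beta> \<omega> x i =
     (let j = i div 2 + 1;
          z = (\<lambda>l. of_real (coord_radius x l) * cis (coord_angle x l));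
          w = cis (- coord_angle x j) * agent_field n A \<tau> \<beta> z j
      in if even i then Re w else Im w / coord_radius x j - \<omega>)"

definition jacobian_mat ::
  "nat \<Rightarrow> ((nat \<Rightarrow> real) \<Rightarrow> nat \<Rightarrow> real) \<Rightarrow> (nat \<Rightarrow> real) \<Rightarrow> real mat" where
  "jacobian_mat m G x = mat m m (\<lambda>(i, k). deriv (\<lambda>s. G (x(k := s)) i) (x k))"

definition linearly_stable_spectrum :: "real mat \<Rightarrow> bool" where
  "linearly_stable_spectrum J \<longleftrightarrow>
     (let M = map_mat complex_of_real J
      in order 0 (char_poly M) = 1 \<and> (\<forall>e. eigenvalue M e \<and> e \<noteq> 0 \<longrightarrow> Re e < 0))"

definition linearly_stable_rotating_state ::
  "nat \<Rightarrow> (nat \<Rightarrow> nat \<Rightarrow> real) \<Rightarrow> real \<Rightarrow> real \<Rightarrow> real \<Rightarrow> (nat \<Rightarrow> real) \<Rightarrow> (nat \<Rightarrow> real) \<Rightarrow> bool" where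
  "linearly_stable_rotating_state n A \<tau> \<beta> \<omega> r \<theta> \<longleftrightarrow>
     (\<forall>j\<in>{1..n}. r j > 0) \<and>
     is_solution n A \<tau> \<beta> (rotating_state \<omega> r \<theta>) \<and>
     (\<forall>i<2 * n. polar_field n A \<tau> \<beta> \<omega> (polar_coords r \<theta>) i = 0) \<and>
     linearly_stable_spectrum
       (jacobian_mat (2 * n) (polar_field n A \<tau> \<beta> \<omega>) (polar_coords r \<theta>))"

definition circ_angle :: "nat \<Rightarrow> nat \<Rightarrow> real" where
  "circ_angle n l = 2 * pi * real l / real n"

definition circulant_block :: "nat \<Rightarrow> (nat \<Rightarrow> real) \<Rightarrow> (nat \<Rightarrow> nat \<Rightarrow> real) \<Rightarrow> bool" where
  "circulant_block n a A \<longleftrightarrow>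
     (\<forall>j\<in>{1..n}. \<forall>l\<in>{1..n}. A j l = a (nat ((int l - int j) mod int n)))"

definition circ_degree :: "nat \<Rightarrow> (nat \<Rightarrow> real) \<Rightarrow> real" where
  "circ_degree n a = (\<Sum>l=1..n-1. a l)"

definition circ_rho :: "nat \<Rightarrow> (nat \<Rightarrow> real) \<Rightarrow> real" where
  "circ_rho n a = (\<Sum>l=1..n-1. a l * cos (circ_angle n l))"

definition circ_omega :: "nat \<Rightarrow> (nat \<Rightarrow> real) \<Rightarrow> real" where
  "circ_omega n a = (\<Sum>l=1..n-1. a l * sin (circ_angle n l))"

definition cone_condition :: "nat \<Rightarrow> (nat \<Rightarrow> real) \<Rightarrow> bool" where
  "cone_condition n a \<longleftrightarrow>
     (\<forall>k\<in>{1..n-1}. (\<Sum>l=1..n-1. a l * cos (circ_angle n l) * (1 - cos (real k * circ_angle n l))) > 0)"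

definition twisted_radius :: "nat \<Rightarrow> (nat \<Rightarrow> real) \<Rightarrow> real \<Rightarrow> real \<Rightarrow> real" where
  "twisted_radius n a \<beta> \<tau> = \<beta> * sqrt (\<tau> * (circ_rho n a - circ_degree n a + 1 / \<tau>))"

text \<open>
  The radius of the twisted state varies with the parameter \<open>\<tau>'\<close> over which the threshold
  quantifies.
\<close>

definition stability_threshold ::
  "nat \<Rightarrow> (nat \<Rightarrow> real) \<Rightarrow> (nat \<Rightarrow> nat \<Rightarrow> real) \<Rightarrow> real \<Rightarrow> real \<Rightarrow> bool" where
  "stability_threshold n a A \<beta> T \<longleftrightarrow>
     0 < T \<and> T \<le> inverse (circ_degree n a - circ_rho n a) \<and>
     (\<forall>\<tau>' \<theta>. 0 < \<tau>' \<and> \<tau>' < T \<longrightarrow>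
        linearly_stable_rotating_state n A \<tau>' \<beta> (circ_omega n a)
          (\<lambda>j. twisted_radius n a \<beta> \<tau>') (\<lambda>j. 2 * pi * real j / real n + \<theta>))"

end

theory Submission
  imports Defs
begin

text \<open>
  Nobody listens to a follower, and every follower listens to one leader only. So the followers
  can be attached to the leader system one at a time, and attaching one keeps the property of
  having a linearly stable rotating state (\<open>attach_follower\<close>). The hypothesis on the
  stability threshold \<open>\<tau>\<^sup>*\<^sup>*\<close> provides the state of the leaders alone, from which an induction on the
  number of followers starts.

  Consider a follower with coupling strength \<open>b\<close>, whose leader moves on the circle of radius
  \<open>R\<close>. Let \<open>r\<close> be its radius and \<open>\<delta>\<close> the angle by which it lags behind its leader, and put
  \<open>s = r\<^sup>2 / \<beta>\<^sup>2\<close> and \<open>c = b - (1 - s) / \<tau>\<close>. The follower rotates rigidly with the leader iff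
  \<open>b R e\<^bsup>i\<delta>\<^esup> = r (c + i \<omega>)\<close>. The phase \<open>\<delta>\<close> is then the argument of \<open>c + i \<omega>\<close>, and what remains is
  the equation \<open>b\<^sup>2 R\<^sup>2 = \<beta>\<^sup>2 s (c\<^sup>2 + \<omega>\<^sup>2)\<close> of the moduli, whose right side tends to infinity
  with \<open>s\<close>. If \<open>b \<tau> \<ge> 1\<close>, every solution \<open>s > 0\<close> has \<open>c > 0\<close>, and one exists because the right
  side vanishes at \<open>s = 0\<close>. Otherwise, at \<open>s = 1 - b \<tau>\<close>, where \<open>c = 0\<close>, the right side equals
  \<open>\<beta>\<^sup>2 \<omega>\<^sup>2 (1 - b \<tau>)\<close>; this lies below \<open>b\<^sup>2 R\<^sup>2\<close> iff \<open>b\<close> exceeds the positive root \<open>a\<^sup>*\<close> of a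
  quadratic. Hence, for \<open>b > a\<^sup>*\<close>, the intermediate value theorem finds a solution with \<open>c > 0\<close>
  (\<open>follower_equilibrium_exists\<close>).

  The positivity of \<open>c\<close> is what makes the follower stable. The Jacobian of the enlarged system is
  block lower triangular. Its upper left block is the old Jacobian, and its lower right block is
  the matrix with rows \<open>(- c - 2 s / \<tau>, \<omega> r)\<close> and \<open>(- \<omega> / r, - c)\<close>
  (\<open>jacobian_follower_block\<close>), whose trace is negative and whose determinant
  \<open>c (c + 2 s / \<tau>) + \<omega>\<^sup>2\<close> is positive. So the two new eigenvalues have negative real part, and \<open>0\<close>
  remains a simple eigenvalue (\<open>linearly_stable_spectrum_extend\<close>).
\<close>

section \<open>Spectra of block triangular matrices\<close>

lemma char_poly_four_block_upper_right_zero: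
  fixes A :: "'a :: idom mat"
  assumes A: "A \<in> carrier_mat n n" and C: "C \<in> carrier_mat m n" and D: "D \<in> carrier_mat m m"
  shows "char_poly (four_block_mat A (0\<^sub>m n m) C D) = char_poly A * char_poly D"
proof -
  let ?C = "map_mat (\<lambda>c. [:- c:]) C"
  have "char_poly_matrix (four_block_mat A (0\<^sub>m n m) C D)
      = four_block_mat (char_poly_matrix A) (0\<^sub>m n m) ?C (char_poly_matrix D)"
    by (rule eq_matI) (use A C D in \<open>auto simp: char_poly_matrix_def\<close>)
  then show ?thesis
    unfolding char_poly_def
    using det_four_block_mat_upper_right_zero[of "char_poly_matrix A" n _ m ?C "char_poly_matrix D"]
      A C D by simp
qed

lemma char_poly_2x2:
  fixes D :: "'a :: idom mat"
  assumes D: "D \<in> carrier_mat 2 2"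
  shows "char_poly D
    = [: D $$ (0,0) * D $$ (1,1) - D $$ (0,1) * D $$ (1,0), - (D $$ (0,0) + D $$ (1,1)), 1 :]"
proof -
  let ?M = "char_poly_matrix D"
  have M: "?M \<in> carrier_mat 2 2" using D by simp
  have entry: "mat_delete ?M 0 0 $$ (0,0) = ?M $$ (1,1)" "mat_delete ?M 0 1 $$ (0,0) = ?M $$ (1,0)"
    using M by (auto simp: mat_delete_def)
  have carr: "mat_delete ?M 0 0 \<in> carrier_mat 1 1" "mat_delete ?M 0 1 \<in> carrier_mat 1 1"
    using mat_delete_carrier[OF M] by simp_all
  have "Determinant.det ?M = (\<Sum>j<2. ?M $$ (0,j) * cofactor ?M 0 j)"
    using laplace_expansion_row[OF M, of 0] by simp
  also have "\<dots> = ?M $$ (0,0) * ?M $$ (1,1) - ?M $$ (0,1) * ?M $$ (1,0)"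
    using carr entry by (simp add: numeral_2_eq_2 cofactor_def det_single)
  finally show ?thesis
    using D unfolding char_poly_def by (simp add: char_poly_matrix_def algebra_simps)
qed

lemma Re_root_quadratic_neg:
  fixes z :: complex and p q :: real
  assumes "p > 0" "q > 0" and root: "z\<^sup>2 + of_real p * z + of_real q = 0"
  shows "Re z < 0"
proof (cases "Im z = 0")
  case True
  have "(Re z)\<^sup>2 + p * Re z + q = 0"
    using arg_cong[OF root, of Re] True by (simp add: power2_eq_square)
  then show ?thesis
    using assms(1,2) by (smt (verit) mult_nonneg_nonneg zero_le_power2)
next
  case False
  have "Im z * (2 * Re z + p) = 0"
    using arg_cong[OF root, of Im] by (simp add: power2_eq_square algebra_simps)
  then show ?thesis
    using False assms(1) by auto
qed

text \<open>
  By block triangularity the characteristic polynomials multiply. The new factor is a real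
  quadratic with positive coefficients: \<open>0\<close> is not among its roots, so the order of \<open>0\<close> does not
  change, and its roots lie in the open left half-plane.
\<close>

lemma linearly_stable_spectrum_extend:
  fixes J :: "real mat"
  assumes J: "J \<in> carrier_mat (m + 2) (m + 2)"
    and zero: "\<And>i k. i < m \<Longrightarrow> m \<le> k \<Longrightarrow> k < m + 2 \<Longrightarrow> J $$ (i,k) = 0"
    and stable: "linearly_stable_spectrum (mat m m (\<lambda>(i,k). J $$ (i,k)))"
    and trace: "J $$ (m,m) + J $$ (m+1,m+1) < 0"
    and det: "J $$ (m,m) * J $$ (m+1,m+1) - J $$ (m,m+1) * J $$ (m+1,m) > 0"
  shows "linearly_stable_spectrum J"
proof -
  let ?c = "map_mat complex_of_real"
  define L where "L = ?c (mat m m (\<lambda>(i,k). J $$ (i,k)))"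
  define C where "C = ?c (mat 2 m (\<lambda>(i,k). J $$ (m+i,k)))"
  define D where "D = ?c (mat 2 2 (\<lambda>(i,k). J $$ (m+i,m+k)))"
  define p where "p = - (J $$ (m,m) + J $$ (m+1,m+1))"
  define q where "q = J $$ (m,m) * J $$ (m+1,m+1) - J $$ (m,m+1) * J $$ (m+1,m)"
  have carr: "L \<in> carrier_mat m m" "C \<in> carrier_mat 2 m" "D \<in> carrier_mat 2 2"
    by (auto simp: L_def C_def D_def)
  have split: "?c J = four_block_mat L (0\<^sub>m m 2) C D"
    by (rule eq_matI) (use J zero in \<open>auto simp: L_def C_def D_def\<close>)
  have D: "char_poly D = [: of_real q, of_real p, 1 :]"
    unfolding char_poly_2x2[OF carr(3)] by (simp add: D_def p_def q_def)
  have cp: "char_poly (?c J) = char_poly L * [: of_real q, of_real p, 1 :]"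
    unfolding split char_poly_four_block_upper_right_zero[OF carr] D ..
  have pq: "p > 0" "q > 0" using trace det by (simp_all add: p_def q_def)
  have L0: "order 0 (char_poly L) = 1"
    and Lneg: "\<And>e. eigenvalue L e \<Longrightarrow> e \<noteq> 0 \<Longrightarrow> Re e < 0"
    using stable unfolding linearly_stable_spectrum_def L_def Let_def by auto
  have Lnz: "char_poly L \<noteq> 0"
    using degree_monic_char_poly[OF carr(1)] by auto
  have "order 0 (char_poly (?c J)) = 1"
  proof -
    have "order 0 [: complex_of_real q, of_real p, 1 :] = 0"
      using pq by (intro order_0I) simp
    moreover have "char_poly L * [: of_real q, of_real p, 1 :] \<noteq> 0"
      using Lnz by (intro no_zero_divisors) auto
    ultimately show ?thesis
      unfolding cp using L0 by (simp add: order_mult del: mult_pCons_right)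
  qed
  moreover have "Re e < 0" if e: "eigenvalue (?c J) e" "e \<noteq> 0" for e
  proof -
    have "poly (char_poly (?c J)) e = 0"
      using e(1) eigenvalue_root_char_poly[of "?c J" "m + 2" e] J by simp
    then have "poly (char_poly L) e = 0 \<or> poly [: of_real q, of_real p, 1 :] e = 0"
      unfolding cp poly_mult mult_eq_0_iff .
    then consider "poly (char_poly L) e = 0" | "e\<^sup>2 + of_real p * e + of_real q = 0"
      by (auto simp: power2_eq_square algebra_simps)
    then show ?thesis
      using Lneg e(2) eigenvalue_root_char_poly[OF carr(1)] Re_root_quadratic_neg pq by metis
  qed
  ultimately show ?thesis
    unfolding linearly_stable_spectrum_def Let_def by blast
qed

section \<open>The equilibrium of a follower\<close>

text \<open>
  The real and imaginary parts of \<open>b R e\<^bsup>i\<delta>\<^esup> = r (c + i \<omega>)\<close>, with the additional demand \<open>c > 0\<close>.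
  In the variable \<open>s = r\<^sup>2 / \<beta>\<^sup>2\<close> this demand reads \<open>s > 1 - b \<tau>\<close>, so the root of the modulus
  equation is sought to the right of \<open>max 0 (1 - b \<tau>)\<close>.
\<close>

lemma follower_equilibrium_exists:
  fixes \<tau> \<beta> \<omega> R b :: real
  assumes pos: "\<tau> > 0" "\<beta> > 0" "R > 0" "b > 0" and "\<omega> \<noteq> 0"
    and b: "b > \<tau> * \<omega>\<^sup>2 * \<beta>\<^sup>2 / (2 * R\<^sup>2) * (sqrt (1 + 4 * R\<^sup>2 / (\<omega>\<^sup>2 * \<tau>\<^sup>2 * \<beta>\<^sup>2)) - 1)"
  obtains r \<delta> where "r > 0" and "b - 1 / \<tau> * (1 - r\<^sup>2 / \<beta>\<^sup>2) > 0"
    and "b * R * cos \<delta> = r * (b - 1 / \<tau> * (1 - r\<^sup>2 / \<beta>\<^sup>2))"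
    and "b * R * sin \<delta> = \<omega> * r"
proof -
  \<comment> \<open>the squared modulus of \<open>r (c + i \<omega>)\<close> as a function of \<open>s\<close>\<close>
  define h where "h s = s * \<beta>\<^sup>2 * ((b - 1 / \<tau> * (1 - s))\<^sup>2 + \<omega>\<^sup>2)" for s
  define s0 where "s0 = max 0 (1 - b * \<tau>)"
  \<comment> \<open>since \<open>h s \<ge> s \<beta>\<^sup>2 \<omega>\<^sup>2\<close> for \<open>s \<ge> 0\<close>, this is far enough to the right\<close>
  define s1 where "s1 = s0 + b\<^sup>2 * R\<^sup>2 / (\<beta>\<^sup>2 * \<omega>\<^sup>2)"
  \<comment> \<open>the lower bound on \<open>b\<close>, freed of its square root, says \<open>h (1 - b \<tau>) < b\<^sup>2 R\<^sup>2\<close>\<close>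
  have threshold: "\<omega>\<^sup>2 * \<beta>\<^sup>2 < b\<^sup>2 * R\<^sup>2 + b * \<tau> * \<omega>\<^sup>2 * \<beta>\<^sup>2"
  proof -
    define K where "K = \<tau> * \<omega>\<^sup>2 * \<beta>\<^sup>2 / (2 * R\<^sup>2)"
    define q where "q = 1 + 4 * R\<^sup>2 / (\<omega>\<^sup>2 * \<tau>\<^sup>2 * \<beta>\<^sup>2)"
    have K: "K > 0" using pos \<open>\<omega> \<noteq> 0\<close> by (simp add: K_def)
    have q: "q \<ge> 0" by (simp add: q_def add_nonneg_nonneg)
    have "K * sqrt q < b + K"
      using b unfolding K_def[symmetric] q_def[symmetric] by (simp add: algebra_simps)
    then have "(K * sqrt q)\<^sup>2 < (b + K)\<^sup>2"
      using K q by (intro power_strict_mono) auto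
    then have "K\<^sup>2 * (q - 1) < b\<^sup>2 + 2 * b * K"
      using q by (simp add: power_mult_distrib power2_sum algebra_simps)
    moreover have "K\<^sup>2 * (q - 1) = \<omega>\<^sup>2 * \<beta>\<^sup>2 / R\<^sup>2"
      using pos \<open>\<omega> \<noteq> 0\<close> by (simp add: K_def q_def field_simps power2_eq_square)
    ultimately have "\<omega>\<^sup>2 * \<beta>\<^sup>2 < R\<^sup>2 * (b\<^sup>2 + 2 * b * K)"
      using pos by (simp add: pos_divide_less_eq mult.commute)
    also have "\<dots> = b\<^sup>2 * R\<^sup>2 + b * \<tau> * \<omega>\<^sup>2 * \<beta>\<^sup>2"
      using pos by (simp add: K_def field_simps)
    finally show ?thesis .
  qed
  have low: "h s0 < b\<^sup>2 * R\<^sup>2"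
  proof (cases "1 - b * \<tau> \<le> 0")
    case True
    then show ?thesis using pos by (simp add: h_def s0_def)
  next
    case False
    then have "h s0 = (1 - b * \<tau>) * \<beta>\<^sup>2 * \<omega>\<^sup>2"
      using pos by (simp add: h_def s0_def)
    then show ?thesis using threshold by (simp add: algebra_simps)
  qed
  have "s0 \<ge> 0" "s0 \<le> s1" by (simp_all add: s0_def s1_def)
  have high: "b\<^sup>2 * R\<^sup>2 \<le> h s1"
  proof -
    have "b\<^sup>2 * R\<^sup>2 = (s1 - s0) * \<beta>\<^sup>2 * \<omega>\<^sup>2"
      using pos \<open>\<omega> \<noteq> 0\<close> by (simp add: s1_def)
    also have "\<dots> \<le> s1 * \<beta>\<^sup>2 * \<omega>\<^sup>2"
      using \<open>s0 \<ge> 0\<close> by (intro mult_right_mono) auto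
    also have "\<dots> \<le> h s1"
      unfolding h_def using \<open>s0 \<ge> 0\<close> \<open>s0 \<le> s1\<close> by (intro mult_left_mono) auto
    finally show ?thesis .
  qed
  have "continuous_on {s0..s1} h"
    unfolding h_def by (intro continuous_intros)
  then obtain s where s: "s0 \<le> s" "s \<le> s1" "h s = b\<^sup>2 * R\<^sup>2"
    using IVT'[of h s0 "b\<^sup>2 * R\<^sup>2" s1] low high \<open>s0 \<le> s1\<close> by auto
  have "s \<noteq> s0" using s(3) low by auto
  then have "s > s0" using s(1) by simp
  define r where "r = \<beta> * sqrt s"
  define c where "c = b - 1 / \<tau> * (1 - s)"
  have "s > 0" "1 - b * \<tau> < s" using \<open>s > s0\<close> by (auto simp: s0_def)
  then have "r > 0" and c: "c > 0"
    using pos by (simp_all add: r_def c_def field_simps)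
  have r2: "r\<^sup>2 / \<beta>\<^sup>2 = s"
    using pos \<open>s > 0\<close> by (simp add: r_def power_mult_distrib)
  define w where "w = Complex c \<omega>"
  have "w \<noteq> 0" using c by (simp add: w_def Complex_eq_0)
  have "b * R = r * cmod w"
  proof (rule power2_eq_imp_eq)
    have "(r * cmod w)\<^sup>2 = r\<^sup>2 * (c\<^sup>2 + \<omega>\<^sup>2)"
      by (simp add: w_def cmod_def power_mult_distrib)
    also have "\<dots> = h s"
      using \<open>s > 0\<close> by (simp add: h_def c_def r_def power_mult_distrib)
    finally show "(b * R)\<^sup>2 = (r * cmod w)\<^sup>2"
      using s(3) by (simp add: power_mult_distrib)
  qed (use pos \<open>r > 0\<close> in auto)
  moreover have "cmod w * cos (Arg w) = c" "cmod w * sin (Arg w) = \<omega>"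
    using arg_cong[OF rcis_cmod_Arg[of w], of Re] arg_cong[OF rcis_cmod_Arg[of w], of Im] 
    by (simp_all add: w_def)
  ultimately have "b * R * cos (Arg w) = r * c" "b * R * sin (Arg w) = \<omega> * r"
    by (simp_all add: mult.assoc) 
  then show ?thesis
    using that[of r "Arg w"] \<open>r > 0\<close> c unfolding c_def r2 by simp
qed

section \<open>The vector field of a system with one more agent\<close>

lemma agent_field_cong:
  assumes "\<forall>l\<in>{1..n}. z l = z' l" and "j \<in> {1..n}"
  shows "agent_field n A \<tau> \<beta> z j = agent_field n A \<tau> \<beta> z' j"
proof -
  have "(\<Sum>l\<in>{1..n}. of_real (A j l) * (z l - z j)) = (\<Sum>l\<in>{1..n}. of_real (A j l) * (z' l - z' j))"
    using assms by (intro sum.cong) auto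
  then show ?thesis
    using assms by (simp add: agent_field_def)
qed

lemma agent_field_Suc_uninfluenced:
  assumes "A j (Suc n) = 0"
  shows "agent_field (Suc n) A \<tau> \<beta> z j = agent_field n A \<tau> \<beta> z j"
  using assms by (simp add: agent_field_def atLeastAtMostSuc_conv)

lemma agent_field_single_source:
  assumes "i \<in> {1..n}" and "\<forall>l\<in>{1..n}. l \<noteq> i \<longrightarrow> A (Suc n) l = 0"
  shows "agent_field (Suc n) A \<tau> \<beta> z (Suc n)
    = of_real (A (Suc n) i) * (z i - z (Suc n))
      + of_real (1 / \<tau> * (1 - (cmod (z (Suc n)))\<^sup>2 / \<beta>\<^sup>2)) * z (Suc n)"
proof -
  have "(\<Sum>l\<in>{1..Suc n}. of_real (A (Suc n) l) * (z l - z (Suc n)))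
      = (\<Sum>l\<in>{1..n}. of_real (A (Suc n) l) * (z l - z (Suc n)))"
    by (simp add: atLeastAtMostSuc_conv)
  also have "\<dots> = (\<Sum>l\<in>{i}. of_real (A (Suc n) l) * (z l - z (Suc n)))"
    using assms by (intro sum.mono_neutral_right) auto
  finally show ?thesis
    by (simp add: agent_field_def)
qed

lemma polar_field_Suc_uninfluenced:
  assumes "\<forall>j\<in>{1..n}. A j (Suc n) = 0" and "i < 2 * n"
  shows "polar_field (Suc n) A \<tau> \<beta> \<omega> x i = polar_field n A \<tau> \<beta> \<omega> x i"
proof -
  have "i div 2 + 1 \<in> {1..n}" using assms(2) by auto
  then show ?thesis
    using assms(1) by (simp add: polar_field_def agent_field_Suc_uninfluenced)
qed

lemma polar_field_cong:
  assumes eq: "\<forall>k<2 * n. x k = y k" and i: "i < 2 * n"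
  shows "polar_field n A \<tau> \<beta> \<omega> x i = polar_field n A \<tau> \<beta> \<omega> y i"
proof -
  have coords: "coord_radius x l = coord_radius y l" "coord_angle x l = coord_angle y l"
    if "l \<in> {1..n}" for l
    using that by (auto simp: coord_radius_def coord_angle_def intro!: eq[rule_format])
  have j: "i div 2 + 1 \<in> {1..n}" using i by auto
  have "agent_field n A \<tau> \<beta> (\<lambda>l. of_real (coord_radius x l) * cis (coord_angle x l)) (i div 2 + 1)
      = agent_field n A \<tau> \<beta> (\<lambda>l. of_real (coord_radius y l) * cis (coord_angle y l)) (i div 2 + 1)"
    using coords j by (intro agent_field_cong) auto
  then show ?thesis
    using coords[OF j] by (simp add: polar_field_def Let_def)
qed

text \<open>
  In 0-based coordinates the agent \<open>n + 1\<close> owns the positions \<open>2 n\<close> (radius) and \<open>2 n + 1\<close>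
  (angle). Only the difference between its angle and that of its source enters, which is why
  rigid rotation turns into a fixed point condition.
\<close>

lemma polar_field_single_source:
  assumes "i \<in> {1..n}" and "\<forall>l\<in>{1..n}. l \<noteq> i \<longrightarrow> A (Suc n) l = 0"
  shows "polar_field (Suc n) A \<tau> \<beta> \<omega> x (2 * n)
      = A (Suc n) i * (coord_radius x i * cos (coord_angle x i - x (2 * n + 1)) - x (2 * n))
        + 1 / \<tau> * (1 - (x (2 * n))\<^sup>2 / \<beta>\<^sup>2) * x (2 * n)"
    and "polar_field (Suc n) A \<tau> \<beta> \<omega> x (2 * n + 1)
      = A (Suc n) i * coord_radius x i * sin (coord_angle x i - x (2 * n + 1)) / x (2 * n) - \<omega>"
proof -
  define z where "z = (\<lambda>l. of_real (coord_radius x l) * cis (coord_angle x l))"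
  have new: "coord_radius x (Suc n) = x (2 * n)" "coord_angle x (Suc n) = x (2 * n + 1)"
    by (simp_all add: coord_radius_def coord_angle_def)
  define g where "g = 1 / \<tau> * (1 - (x (2 * n))\<^sup>2 / \<beta>\<^sup>2)"
  have "cis (- x (2 * n + 1)) * agent_field (Suc n) A \<tau> \<beta> z (Suc n)
      = of_real (A (Suc n) i)
          * (of_real (coord_radius x i) * (cis (- x (2 * n + 1)) * cis (coord_angle x i))
             - of_real (x (2 * n)) * (cis (- x (2 * n + 1)) * cis (x (2 * n + 1))))
        + of_real (g * x (2 * n)) * (cis (- x (2 * n + 1)) * cis (x (2 * n + 1)))"
    unfolding agent_field_single_source[where A = A, OF assms] g_def
    by (simp add: z_def new norm_mult algebra_simps)
  also have "\<dots> = of_real (A (Suc n) i)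
          * (of_real (coord_radius x i) * cis (coord_angle x i - x (2 * n + 1)) - of_real (x (2 * n)))
        + of_real (g * x (2 * n))"
    by (simp add: cis_mult)
  finally have w: "cis (- x (2 * n + 1)) * agent_field (Suc n) A \<tau> \<beta> z (Suc n) = \<dots>" .
  show "polar_field (Suc n) A \<tau> \<beta> \<omega> x (2 * n)
      = A (Suc n) i * (coord_radius x i * cos (coord_angle x i - x (2 * n + 1)) - x (2 * n))
        + 1 / \<tau> * (1 - (x (2 * n))\<^sup>2 / \<beta>\<^sup>2) * x (2 * n)"
    using arg_cong[OF w, of Re] new
    by (simp add: polar_field_def Let_def z_def g_def)
  show "polar_field (Suc n) A \<tau> \<beta> \<omega> x (2 * n + 1)
      = A (Suc n) i * coord_radius x i * sin (coord_angle x i - x (2 * n + 1)) / x (2 * n) - \<omega>"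
    using arg_cong[OF w, of Im] new
    by (simp add: polar_field_def Let_def z_def)
qed

section \<open>The Jacobian of a system with one more agent\<close>

text \<open>
  The old agents do not see the new one. Their rows of the Jacobian therefore consist of the old
  Jacobian followed by zeros.
\<close>

lemma jacobian_Suc_uninfluenced:
  assumes A: "\<forall>j\<in>{1..n}. A j (Suc n) = 0"
    and eq: "\<forall>k<2 * n. x k = y k" and i: "i < 2 * n"
  shows "k < 2 * n \<Longrightarrow> jacobian_mat (2 * Suc n) (polar_field (Suc n) A \<tau> \<beta> \<omega>) x $$ (i,k)
      = jacobian_mat (2 * n) (polar_field n A \<tau> \<beta> \<omega>) y $$ (i,k)"
    and "2 * n \<le> k \<Longrightarrow> k < 2 * Suc n \<Longrightarrow>
      jacobian_mat (2 * Suc n) (polar_field (Suc n) A \<tau> \<beta> \<omega>) x $$ (i,k) = 0"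
proof -
  have field: "polar_field (Suc n) A \<tau> \<beta> \<omega> x' i = polar_field n A \<tau> \<beta> \<omega> x' i" for x'
    using polar_field_Suc_uninfluenced[where A = A, OF A i] .
  show "jacobian_mat (2 * Suc n) (polar_field (Suc n) A \<tau> \<beta> \<omega>) x $$ (i,k)
      = jacobian_mat (2 * n) (polar_field n A \<tau> \<beta> \<omega>) y $$ (i,k)" if "k < 2 * n"
  proof -
    have "polar_field n A \<tau> \<beta> \<omega> (x(k := s)) i = polar_field n A \<tau> \<beta> \<omega> (y(k := s)) i" for s
      using eq i by (intro polar_field_cong) auto
    then show ?thesis
      using i that eq by (simp add: jacobian_mat_def field)
  qed
  show "jacobian_mat (2 * Suc n) (polar_field (Suc n) A \<tau> \<beta> \<omega>) x $$ (i,k) = 0"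
    if "2 * n \<le> k" "k < 2 * Suc n"
  proof -
    have "polar_field n A \<tau> \<beta> \<omega> (x(k := s)) i = polar_field n A \<tau> \<beta> \<omega> x i" for s
      using i that by (intro polar_field_cong) auto
    then show ?thesis
      using i that by (simp add: jacobian_mat_def field)
  qed
qed

text \<open>
  The partial derivatives of the two components of the follower's field contain \<open>b R cos \<delta>\<close> and
  \<open>b R sin \<delta>\<close>. The equilibrium equations replace these by \<open>r c\<close> and \<open>\<omega> r\<close>, which gives entries
  that no longer mention the leader.
\<close>

lemma jacobian_follower_block:
  assumes i: "i \<in> {1..n}" and A: "\<forall>l\<in>{1..n}. l \<noteq> i \<longrightarrow> A (Suc n) l = 0"
    and r: "x (2 * n) = r" "r > 0"
    and radial: "A (Suc n) i * coord_radius x i * cos (coord_angle x i - x (2 * n + 1))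
      = r * (A (Suc n) i - 1 / \<tau> * (1 - r\<^sup>2 / \<beta>\<^sup>2))"
    and angular: "A (Suc n) i * coord_radius x i * sin (coord_angle x i - x (2 * n + 1)) = \<omega> * r"
  defines "J \<equiv> jacobian_mat (2 * Suc n) (polar_field (Suc n) A \<tau> \<beta> \<omega>) x"
    and "c \<equiv> A (Suc n) i - 1 / \<tau> * (1 - r\<^sup>2 / \<beta>\<^sup>2)"
  shows "J $$ (2 * n, 2 * n) = - c - 2 * (r\<^sup>2 / \<beta>\<^sup>2) / \<tau>"
    and "J $$ (2 * n, 2 * n + 1) = \<omega> * r"
    and "J $$ (2 * n + 1, 2 * n) = - \<omega> / r"
    and "J $$ (2 * n + 1, 2 * n + 1) = - c"
proof -
  define b where "b = A (Suc n) i"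
  define P where "P = coord_radius x i"
  define \<alpha> where "\<alpha> = coord_angle x i"
  define \<phi> where "\<phi> = x (2 * n + 1)"
  have coords: "coord_radius (x(k := s)) i = P" "coord_angle (x(k := s)) i = \<alpha>"
    if "k \<ge> 2 * n" for k s
  proof -
    have "2 * (i - 1) + 1 < k" using i that by auto
    then show "coord_radius (x(k := s)) i = P" "coord_angle (x(k := s)) i = \<alpha>"
      by (auto simp: P_def \<alpha>_def coord_radius_def coord_angle_def)
  qed
  have angle: "x (Suc (2 * n)) = \<phi>" by (simp add: \<phi>_def)
  note field = polar_field_single_source[where A = A, OF i A, folded b_def Suc_eq_plus1]
  have rad: "b * P * cos (\<alpha> - \<phi>) = r * c" and ang: "b * P * sin (\<alpha> - \<phi>) = \<omega> * r"
    using radial angular by (simp_all add: b_def P_def \<alpha>_def \<phi>_def c_def)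
  \<comment> \<open>quotients enter as the constants \<open>T\<close>, \<open>B\<close>, which leaves a polynomial in \<open>s\<close> to differentiate\<close>
  have "((\<lambda>s. b * (P * cos (\<alpha> - \<phi>) - s) + T * (1 - s\<^sup>2 * B) * s)
      has_real_derivative - (b - T * (1 - r\<^sup>2 * B)) - 2 * (r\<^sup>2 * B) * T) (at r)" for T B :: real
    by (auto intro!: derivative_eq_intros simp: algebra_simps power2_eq_square)
  from this[of "1 / \<tau>" "1 / \<beta>\<^sup>2"]
  have "((\<lambda>s. b * (P * cos (\<alpha> - \<phi>) - s) + 1 / \<tau> * (1 - s\<^sup>2 / \<beta>\<^sup>2) * s)
      has_real_derivative - c - 2 * (r\<^sup>2 / \<beta>\<^sup>2) / \<tau>) (at r)"
    by (simp add: c_def b_def)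
  then show "J $$ (2 * n, 2 * n) = - c - 2 * (r\<^sup>2 / \<beta>\<^sup>2) / \<tau>"
    using r by (simp add: J_def jacobian_mat_def field coords angle) (rule DERIV_imp_deriv)
  have "((\<lambda>s. b * (P * cos (\<alpha> - s) - r) + 1 / \<tau> * (1 - r\<^sup>2 / \<beta>\<^sup>2) * r)
      has_real_derivative \<omega> * r) (at \<phi>)"
    unfolding ang[symmetric] by (auto intro!: derivative_eq_intros)
  then show "J $$ (2 * n, 2 * n + 1) = \<omega> * r"
    using r by (simp add: J_def jacobian_mat_def field coords angle) (rule DERIV_imp_deriv)
  have "((\<lambda>s. b * P * sin (\<alpha> - \<phi>) / s - \<omega>) has_real_derivative - \<omega> / r) (at r)"
    unfolding ang using r by (auto intro!: derivative_eq_intros)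
  then show "J $$ (2 * n + 1, 2 * n) = - \<omega> / r"
    using r by (simp add: J_def jacobian_mat_def field coords angle) (rule DERIV_imp_deriv)
  have "((\<lambda>s. b * P * sin (\<alpha> - s) / r - \<omega>) has_real_derivative - (b * P * cos (\<alpha> - \<phi>)) / r) (at \<phi>)"
    using r by (auto intro!: derivative_eq_intros)
  then have "((\<lambda>s. b * P * sin (\<alpha> - s) / r - \<omega>) has_real_derivative - c) (at \<phi>)"
    unfolding rad using r by simp
  then show "J $$ (2 * n + 1, 2 * n + 1) = - c"
    using r by (simp add: J_def jacobian_mat_def field coords angle) (rule DERIV_imp_deriv)
qed

section \<open>Attaching followers to a stable rotating state\<close>

text \<open>
  The source \<open>i\<close> may be any agent already present, with \<open>r i\<close> in the role of the leader's radius.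
  The old coordinates keep their values, so solution property, fixed point and spectrum of the old
  system carry over, and only the equations and the diagonal block of the new agent have to be
  examined.
\<close>

lemma attach_follower:
  fixes A :: "nat \<Rightarrow> nat \<Rightarrow> real" and r \<theta> :: "nat \<Rightarrow> real"
  assumes stable: "linearly_stable_rotating_state n A \<tau> \<beta> \<omega> r \<theta>"
    and pos: "\<tau> > 0" "\<beta> > 0" "A (Suc n) i > 0" and "\<omega> \<noteq> 0"
    and col: "\<forall>j\<in>{1..n}. A j (Suc n) = 0"
    and i: "i \<in> {1..n}" and row: "\<forall>l\<in>{1..n}. l \<noteq> i \<longrightarrow> A (Suc n) l = 0"
    and strong: "A (Suc n) i > \<tau> * \<omega>\<^sup>2 * \<beta>\<^sup>2 / (2 * (r i)\<^sup>2)
      * (sqrt (1 + 4 * (r i)\<^sup>2 / (\<omega>\<^sup>2 * \<tau>\<^sup>2 * \<beta>\<^sup>2)) - 1)"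
  shows "\<exists>\<rho> \<phi>. \<rho> > 0 \<and>
    linearly_stable_rotating_state (Suc n) A \<tau> \<beta> \<omega> (r(Suc n := \<rho>)) (\<theta>(Suc n := \<phi>))"
proof -
  define b where "b = A (Suc n) i"
  have rpos: "\<And>j. j \<in> {1..n} \<Longrightarrow> r j > 0"
    and sol: "is_solution n A \<tau> \<beta> (rotating_state \<omega> r \<theta>)"
    and fixed: "\<And>k. k < 2 * n \<Longrightarrow> polar_field n A \<tau> \<beta> \<omega> (polar_coords r \<theta>) k = 0"
    and spec: "linearly_stable_spectrum
      (jacobian_mat (2 * n) (polar_field n A \<tau> \<beta> \<omega>) (polar_coords r \<theta>))"
    using stable unfolding linearly_stable_rotating_state_def by auto
  obtain \<rho> \<delta> where \<rho>: "\<rho> > 0"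
    and c: "b - 1 / \<tau> * (1 - \<rho>\<^sup>2 / \<beta>\<^sup>2) > 0"
    and radial: "b * r i * cos \<delta> = \<rho> * (b - 1 / \<tau> * (1 - \<rho>\<^sup>2 / \<beta>\<^sup>2))"
    and angular: "b * r i * sin \<delta> = \<omega> * \<rho>"
    using follower_equilibrium_exists[OF pos(1,2) rpos[OF i] pos(3) \<open>\<omega> \<noteq> 0\<close> strong]
    unfolding b_def by blast
  define \<phi> where "\<phi> = \<theta> i - \<delta>"
  define r' where "r' = r(Suc n := \<rho>)"
  define \<theta>' where "\<theta>' = \<theta>(Suc n := \<phi>)"
  define x where "x = polar_coords r' \<theta>'"
  define g where "g = 1 / \<tau> * (1 - \<rho>\<^sup>2 / \<beta>\<^sup>2)"
  define J where "J = jacobian_mat (2 * Suc n) (polar_field (Suc n) A \<tau> \<beta> \<omega>) x"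
  have x_old: "\<forall>k<2 * n. x k = polar_coords r \<theta> k"
    by (auto simp: x_def polar_coords_def r'_def \<theta>'_def)
  have x_new: "x (2 * n) = \<rho>" "x (2 * n + 1) = \<phi>"
    by (simp_all add: x_def polar_coords_def r'_def \<theta>'_def)
  have x_src: "coord_radius x i = r i" "coord_angle x i - x (2 * n + 1) = \<delta>"
    using i unfolding x_new
    by (auto simp: coord_radius_def coord_angle_def x_def polar_coords_def r'_def \<theta>'_def \<phi>_def)

  have "is_solution (Suc n) A \<tau> \<beta> (rotating_state \<omega> r' \<theta>')"
    unfolding is_solution_def
  proof (intro allI ballI)
    fix t j assume "j \<in> {1..Suc n}"
    then consider (old) "j \<in> {1..n}" | (new) "j = Suc n" by fastforce
    then show "((\<lambda>s. rotating_state \<omega> r' \<theta>' s j) has_vector_derivative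
        agent_field (Suc n) A \<tau> \<beta> (rotating_state \<omega> r' \<theta>' t) j) (at t)"
    proof cases
      case old
      have same: "\<forall>l\<in>{1..n}. rotating_state \<omega> r' \<theta>' s l = rotating_state \<omega> r \<theta> s l" for s
        by (auto simp: rotating_state_def r'_def \<theta>'_def)
      show ?thesis
        using sol[unfolded is_solution_def, rule_format, OF old, of t] same old
          agent_field_cong[OF same old] agent_field_Suc_uninfluenced[of A j n] col
        by simp
    next
      case new
      let ?e = "cis (\<omega> * t + \<phi>)"
      \<comment> \<open>By rotational symmetry the factor \<open>?e\<close> splits off, and the equation at time \<open>t\<close> becomes
          the time independent equilibrium equation \<open>balance\<close>.\<close>
      have "\<omega> * t + \<theta> i = (\<omega> * t + \<phi>) + \<delta>" by (simp add: \<phi>_def)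
      then have src: "cis (\<omega> * t + \<theta> i) = ?e * cis \<delta>" by (simp only: cis_mult)
      have balance: "of_real b * of_real (r i) * cis \<delta> = of_real \<rho> * (of_real (b - g) + \<i> * of_real \<omega>)"
        using radial angular by (simp add: complex_eq_iff g_def)
      have "agent_field (Suc n) A \<tau> \<beta> (rotating_state \<omega> r' \<theta>' t) (Suc n)
          = of_real b * (of_real (r i) * (?e * cis \<delta>) - of_real \<rho> * ?e) + of_real g * (of_real \<rho> * ?e)"
        using i \<rho> by (subst agent_field_single_source[where A = A, OF i row])
          (auto simp: rotating_state_def r'_def \<theta>'_def g_def b_def norm_mult src[symmetric])
      also have "\<dots> = ?e * (of_real b * of_real (r i) * cis \<delta> - of_real (b - g) * of_real \<rho>)"
        by (simp add: algebra_simps)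
      also have "\<dots> = of_real \<rho> * (\<i> * of_real \<omega> * ?e)"
        unfolding balance by (simp add: algebra_simps)
      finally have field: "agent_field (Suc n) A \<tau> \<beta> (rotating_state \<omega> r' \<theta>' t) (Suc n) = \<dots>" .
      have "((\<lambda>s. of_real \<rho> * cis (\<omega> * s + \<phi>)) has_vector_derivative
          of_real \<rho> * (\<i> * of_real \<omega> * ?e)) (at t)"
        unfolding cis_conv_exp
        by (auto intro!: derivative_eq_intros exp_scaleR_has_vector_derivative_right
            has_vector_derivative_real_field simp: algebra_simps)
      then show ?thesis
        unfolding new field by (simp add: rotating_state_def r'_def \<theta>'_def)
    qed
  qed
  moreover have "polar_field (Suc n) A \<tau> \<beta> \<omega> x k = 0" if k: "k < 2 * Suc n" for k
  proof -
    consider (old) "k < 2 * n" | (radius) "k = 2 * n" | (angle) "k = 2 * n + 1"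
      using k by fastforce
    then show ?thesis
    proof cases
      case old
      then show ?thesis
        using polar_field_Suc_uninfluenced[where A = A, OF col old]
          polar_field_cong[OF x_old old] fixed[OF old] by simp
    next
      case radius
      then show ?thesis
        using radial unfolding radius polar_field_single_source(1)[where A = A, OF i row] x_src x_new(1)
        by (simp add: b_def algebra_simps)
    next
      case angle
      then show ?thesis
        using angular \<rho> unfolding angle polar_field_single_source(2)[where A = A, OF i row] x_src x_new(1)
        by (simp add: b_def)
    qed
  qed
  moreover have "linearly_stable_spectrum J"
  proof (rule linearly_stable_spectrum_extend[where m = "2 * n"])
    show "J \<in> carrier_mat (2 * n + 2) (2 * n + 2)"
      by (simp add: J_def jacobian_mat_def)
    show "J $$ (k,l) = 0" if "k < 2 * n" "2 * n \<le> l" "l < 2 * n + 2" for k l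
      using jacobian_Suc_uninfluenced(2)[where A = A, OF col x_old that(1,2)] that(3)
      by (simp add: J_def)
    have "mat (2 * n) (2 * n) (\<lambda>(k,l). J $$ (k,l))
        = jacobian_mat (2 * n) (polar_field n A \<tau> \<beta> \<omega>) (polar_coords r \<theta>)"
      using jacobian_Suc_uninfluenced(1)[where A = A, OF col x_old]
      by (intro eq_matI) (auto simp: J_def jacobian_mat_def)
    then show "linearly_stable_spectrum (mat (2 * n) (2 * n) (\<lambda>(k,l). J $$ (k,l)))"
      using spec by simp
    define s where "s = \<rho>\<^sup>2 / \<beta>\<^sup>2 / \<tau>"
    have "s > 0" using \<rho> pos by (simp add: s_def)
    have "b - g > 0" using c by (simp add: g_def)
    have block: "J $$ (2 * n, 2 * n) = - (b - g) - 2 * s" "J $$ (2 * n, 2 * n + 1) = \<omega> * \<rho>"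
      "J $$ (2 * n + 1, 2 * n) = - \<omega> / \<rho>" "J $$ (2 * n + 1, 2 * n + 1) = - (b - g)"
      using jacobian_follower_block[where A = A and x = x, OF i row x_new(1) \<rho>,
          where \<tau> = \<tau> and \<beta> = \<beta> and \<omega> = \<omega>] radial angular
      unfolding x_src by (simp_all add: J_def b_def g_def s_def)
    show "J $$ (2 * n, 2 * n) + J $$ (2 * n + 1, 2 * n + 1) < 0"
      unfolding block using \<open>b - g > 0\<close> \<open>s > 0\<close> by simp
    have "J $$ (2 * n, 2 * n) * J $$ (2 * n + 1, 2 * n + 1)
        - J $$ (2 * n, 2 * n + 1) * J $$ (2 * n + 1, 2 * n) = (b - g) * (b - g + 2 * s) + \<omega>\<^sup>2"
      unfolding block using \<rho> by (simp add: algebra_simps power2_eq_square)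
    also have "\<dots> > 0"
      using \<open>b - g > 0\<close> \<open>s > 0\<close> by (intro add_pos_nonneg mult_pos_pos) simp_all
    finally show "J $$ (2 * n, 2 * n) * J $$ (2 * n + 1, 2 * n + 1)
        - J $$ (2 * n, 2 * n + 1) * J $$ (2 * n + 1, 2 * n) > 0" .
  qed
  moreover have "\<forall>j\<in>{1..Suc n}. r' j > 0"
    using rpos \<rho> by (auto simp: r'_def le_Suc_eq)
  ultimately have "linearly_stable_rotating_state (Suc n) A \<tau> \<beta> \<omega> r' \<theta>'"
    unfolding linearly_stable_rotating_state_def J_def x_def by blast
  then show ?thesis
    using \<rho> unfolding r'_def \<theta>'_def by blast
qed

theorem theorem7:
  fixes N1 N2 :: nat
    and A :: "nat \<Rightarrow> nat \<Rightarrow> real"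
    and a :: "nat \<Rightarrow> real"
    and src :: "nat \<Rightarrow> nat"
    and \<tau> \<beta> \<tau>ss d \<rho> \<omega> R astar :: real
  assumes "\<tau> > 0" and "\<beta> > 0"
    and "\<forall>j\<in>{1..N1 + N2}. \<forall>l\<in>{1..N1 + N2}. A j l \<ge> 0"
    and "circulant_block N1 a A"
    and "cone_condition N1 a"
    and "\<forall>j\<in>{1..N1 + N2}. \<forall>l\<in>{N1 + 1..N1 + N2}. A j l = 0"
    and "\<forall>k\<in>{N1 + 1..N1 + N2}. src k \<in> {1..N1} \<and> A k (src k) > 0 \<and>
           (\<forall>i\<in>{1..N1}. i \<noteq> src k \<longrightarrow> A k i = 0)"
    and "d = circ_degree N1 a"
    and "\<rho> = circ_rho N1 a"
    and "\<omega> = circ_omega N1 a"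
    and "\<omega> \<noteq> 0"
    and "R = \<beta> * sqrt (\<tau> * (\<rho> - d + 1 / \<tau>))"
    and "stability_threshold N1 a A \<beta> \<tau>ss"
    and "\<tau> < \<tau>ss"
    and "astar = \<tau> * \<omega>\<^sup>2 * \<beta>\<^sup>2 / (2 * R\<^sup>2) * (sqrt (1 + 4 * R\<^sup>2 / (\<omega>\<^sup>2 * \<tau>\<^sup>2 * \<beta>\<^sup>2)) - 1)"
    and "\<forall>k\<in>{N1 + 1..N1 + N2}. A k (src k) > astar"
  shows "\<exists>r \<theta>s \<theta>.
           (\<forall>j\<in>{1..N1}. r j = R \<and> \<theta>s j = 2 * pi * real j / real N1 + \<theta>) \<and>
           (\<forall>k\<in>{N1 + 1..N1 + N2}. r k > 0) \<and>
           linearly_stable_rotating_state (N1 + N2) A \<tau> \<beta> \<omega> r \<theta>s"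
proof -
  \<comment> \<open>A common phase \<open>\<theta> = 0\<close> of the leaders suffices. The radius of the leaders is carried along because
      the bound \<open>astar\<close> on the coupling of the next follower refers to it.\<close>
  have "\<exists>r \<theta>s. (\<forall>j\<in>{1..N1}. r j = R \<and> \<theta>s j = 2 * pi * real j / real N1 + 0) \<and>
      (\<forall>k\<in>{N1 + 1..N1 + m}. r k > 0) \<and> linearly_stable_rotating_state (N1 + m) A \<tau> \<beta> \<omega> r \<theta>s"
    if "m \<le> N2" for m
    using that
  proof (induction m)
    case 0
    have "R = twisted_radius N1 a \<beta> \<tau>"
      using assms(8,9,12) by (simp add: twisted_radius_def)
    then have "linearly_stable_rotating_state N1 A \<tau> \<beta> \<omega> (\<lambda>j. R) (\<lambda>j. 2 * pi * real j / real N1 + 0)"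
      using assms(1,10,13,14) unfolding stability_threshold_def by blast
    then show ?case by auto
  next
    case (Suc m)
    then obtain r \<theta>s where lead: "\<forall>j\<in>{1..N1}. r j = R \<and> \<theta>s j = 2 * pi * real j / real N1 + 0"
      and foll: "\<forall>k\<in>{N1 + 1..N1 + m}. r k > 0"
      and stable: "linearly_stable_rotating_state (N1 + m) A \<tau> \<beta> \<omega> r \<theta>s"
      by auto
    let ?k = "Suc (N1 + m)"
    have k: "?k \<in> {N1 + 1..N1 + N2}" using Suc.prems by simp
    have src: "src ?k \<in> {1..N1}" "A ?k (src ?k) > 0" "A ?k (src ?k) > astar"
      "\<And>i. i \<in> {1..N1} \<Longrightarrow> i \<noteq> src ?k \<Longrightarrow> A ?k i = 0"
      using assms(7,16) k by blast+
    have "A ?k l = 0" if "l \<in> {1..N1 + m}" "l \<noteq> src ?k" for l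
    proof (cases "l \<le> N1")
      case False
      then show ?thesis using assms(6) k that Suc.prems by simp
    qed (use src(4) that in simp)
    then have row: "\<forall>l\<in>{1..N1 + m}. l \<noteq> src ?k \<longrightarrow> A ?k l = 0" by blast
    have "\<exists>\<sigma> \<phi>. \<sigma> > 0 \<and>
        linearly_stable_rotating_state ?k A \<tau> \<beta> \<omega> (r(?k := \<sigma>)) (\<theta>s(?k := \<phi>))"
    proof (rule attach_follower[OF stable assms(1,2) src(2) assms(11)])
      show "\<forall>j\<in>{1..N1 + m}. A j ?k = 0"
        using assms(6) k Suc.prems by simp
      show "src ?k \<in> {1..N1 + m}" using src(1) by simp
      show "A ?k (src ?k) > \<tau> * \<omega>\<^sup>2 * \<beta>\<^sup>2 / (2 * (r (src ?k))\<^sup>2)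
          * (sqrt (1 + 4 * (r (src ?k))\<^sup>2 / (\<omega>\<^sup>2 * \<tau>\<^sup>2 * \<beta>\<^sup>2)) - 1)"
        using src(3) lead src(1) by (simp add: assms(15))
    qed (rule row)
    then obtain \<sigma> \<phi> where "\<sigma> > 0"
      and attached: "linearly_stable_rotating_state ?k A \<tau> \<beta> \<omega> (r(?k := \<sigma>)) (\<theta>s(?k := \<phi>))"
      by blast
    show ?case
      by (rule exI[of _ "r(?k := \<sigma>)"], rule exI[of _ "\<theta>s(?k := \<phi>)"])
        (use lead foll \<open>\<sigma> > 0\<close> attached in \<open>auto simp: fun_upd_def\<close>)
  qed
  then show ?thesis by blast
qed

end
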